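(* Let $\Gamma=\mathrm{SC}(G,R,L,S)$ be a semi-Cayley graph over a finite abelian group $G$ of order $n$, and let $\alpha,\beta$ be nonzero complex numbers. Let $X=\{z\in G:\chi_z(S)=0\}$. Then $(\alpha,\beta)$-revival occurs on $\Gamma$ from a vertex $u=(g,1)$ to a vertex $v=(h,0)$ at time $t$ if and only if, with $a=g^{-1}h$: (a) $X=\emptyset$ and $\chi_z(S)\overline{\chi_a(z)}\in\mathbb{R}$ for all $z\in G$; and (b) for all $z\in G$, $\exp(\imath t\lambda_z^+)=\alpha+d_z^-(\overline{e_z^+})^{-1}\beta\,\overline{\chi_a(z)}$ and $\exp(\imath t\lambda_z^-)=\alpha-d_z^+(\overline{e_z^+})^{-1}\beta\,\overline{\chi_a(z)}$.
   Context: $G$ is a finite abelian group of order $n$, written multiplicatively with identity $1$, identified with $\mathbb{Z}_{n_1}\otimes\cdots\otimes\mathbb{Z}_{n_r}$. For $z=(z_1,\dots,z_r)$, $g=(g_1,\dots,g_r)$ in $G$, $\chi_z(g)=\prod_{s=1}^r\omega_{n_s}^{z_sg_s}$ with $\omega_m=\exp(2\pi\imath/m)$; note $\chi_z(g)=\chi_g(z)$. For $Y\subseteq G$, $\chi_z(Y)=\sum_{y\in Y}\chi_z(y)$. $R,L,S\subseteq G$ with $R=R^{-1}$, $L=L^{-1}$, $1\notin R\cup L$. The semi-Cayley graph $\mathrm{SC}(G,R,L,S)$ has vertex set $\{(g,0),(g,1):g\in G\}$ and edges $\{(g,0),(h,0)\}$ for $hg^{-1}\in R$, $\{(g,1),(h,1)\}$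 for $hg^{-1}\in L$, $\{(g,0),(h,1)\}$ for $hg^{-1}\in S$. For $z\in G$, $\lambda_z^\pm=\frac12\left(\chi_z(R)+\chi_z(L)\pm\sqrt{(\chi_z(R)-\chi_z(L))^2+4|\chi_z(S)|^2}\right)$. Let $x_z=\chi_z(R)-\chi_z(L)\in\mathbb{R}$ and $D_z=\sqrt{x_z^2+4|\chi_z(S)|^2}$. For $z$ with $\chi_z(S)\neq0$ define $d_z^\pm=\dfrac{4|\chi_z(S)|^2}{|x_z\pm D_z|^2+4|\chi_z(S)|^2}$ and $e_z^+=\dfrac{2\chi_z(S)(x_z+D_z)}{|x_z+D_z|^2+4|\chi_z(S)|^2}$. The transition matrix is $H(t)=\exp(\imath tA)$, $A$ the adjacency matrix. For distinct vertices $u,v$, $(\alpha,\beta)$-revival occurs from $u$ to $v$ at time $t$ if $H(t)\mathbf{e}_u=\alpha\mathbf{e}_u+\beta\mathbf{e}_v$ with $|\alpha|^2+|\beta|^2=1$.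
   Formalization: The formal theorem takes a = gh^{-1} instead of a = g^{-1}h: with the stated edge convention the printed version fails, e.g. for G = Z_3, R = L = ∅, S = {1}, u = (0,1), v = (2,0), t = π/4, where revival occurs but (a) does not hold. *)

theory Defs
  imports Complex_Main "HOL-Algebra.Product_Groups" "HOL-Algebra.Elementary_Groups"
begin

text \<open>A simple graph is a pair \<open>(V, E)\<close> of a finite vertex set and a set of two-element subsets of
  \<open>V\<close>. Matrices indexed by \<open>V\<close> are functions of two vertices; entries outside \<open>V\<close> are irrelevant.\<close>

type_synonym 'v graph = "'v set \<times> 'v set set"

type_synonym 'v cmatrix = "'v \<Rightarrow> 'v \<Rightarrow> complex"

definition unit_vec :: "'v \<Rightarrow> 'v \<Rightarrow> complex" where
  "unit_vec u = (\<lambda>w. if w = u then 1 else 0)"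

definition mat_vec :: "'v set \<Rightarrow> 'v cmatrix \<Rightarrow> ('v \<Rightarrow> complex) \<Rightarrow> 'v \<Rightarrow> complex" where
  "mat_vec V M f = (\<lambda>u. \<Sum>w\<in>V. M u w * f w)"

definition mat_mul :: "'v set \<Rightarrow> 'v cmatrix \<Rightarrow> 'v cmatrix \<Rightarrow> 'v cmatrix" where
  "mat_mul V M N = (\<lambda>u v. \<Sum>w\<in>V. M u w * N w v)"

primrec mat_pow :: "'v set \<Rightarrow> 'v cmatrix \<Rightarrow> nat \<Rightarrow> 'v cmatrix" where
  "mat_pow V M 0 = (\<lambda>u v. if u = v then 1 else 0)"
| "mat_pow V M (Suc k) = mat_mul V M (mat_pow V M k)"

definition mat_exp :: "'v set \<Rightarrow> 'v cmatrix \<Rightarrow> 'v cmatrix" where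
  "mat_exp V M = (\<lambda>u v. suminf (\<lambda>k. mat_pow V M k u v / fact k))"

text \<open>The exponential series converges entrywise, so the \<open>suminf\<close> above is meaningful.\<close>

lemma mat_exp_summable:
  assumes "finite V" "u \<in> V" "v \<in> V"
  shows "summable (\<lambda>k. mat_pow V M k u v / fact k)"
proof -
  define B where "B = (\<Sum>x\<in>V. \<Sum>y\<in>V. norm (M x y))"
  have B: "(\<Sum>w\<in>V. norm (M x w)) \<le> B" if "x \<in> V" for x
    unfolding B_def using that assms(1)
    by (intro member_le_sum[where f = "\<lambda>x. \<Sum>y\<in>V. norm (M x y)"]) (auto intro: sum_nonneg)
  have B0: "B \<ge> 0"
    unfolding B_def by (intro sum_nonneg) auto
  have bound: "norm (mat_pow V M k x v) \<le> B ^ k" if "x \<in> V" for k x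
    using that
  proof (induction k arbitrary: x)
    case 0
    then show ?case by simp
  next
    case (Suc k)
    have "norm (mat_pow V M (Suc k) x v) \<le> (\<Sum>w\<in>V. norm (M x w) * norm (mat_pow V M k w v))"
      unfolding mat_pow.simps mat_mul_def by (rule order_trans[OF norm_sum]) (simp add: norm_mult)
    also have "\<dots> \<le> (\<Sum>w\<in>V. norm (M x w) * B ^ k)"
      by (intro sum_mono mult_left_mono Suc.IH) auto
    also have "\<dots> = (\<Sum>w\<in>V. norm (M x w)) * B ^ k"
      by (simp add: sum_distrib_right)
    also have "\<dots> \<le> B * B ^ k"
      by (intro mult_right_mono B Suc.prems zero_le_power B0)
    finally show ?case by simp
  qed
  have "summable (\<lambda>k. B ^ k / fact k)"
    using summable_exp_generic[of B] by (simp add: divide_inverse mult.commute)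
  then show ?thesis
    by (rule summable_comparison_test'[where N = 0])
      (use bound assms in \<open>auto simp: norm_divide intro!: divide_right_mono\<close>)
qed

definition adjacency_matrix :: "'v graph \<Rightarrow> 'v cmatrix" where
  "adjacency_matrix \<Gamma> = (\<lambda>u v. if {u, v} \<in> snd \<Gamma> then 1 else 0)"

definition transition_matrix :: "'v graph \<Rightarrow> real \<Rightarrow> 'v cmatrix" where
  "transition_matrix \<Gamma> t =
     mat_exp (fst \<Gamma>) (\<lambda>u v. \<i> * complex_of_real t * adjacency_matrix \<Gamma> u v)"

definition revival :: "'v graph \<Rightarrow> complex \<Rightarrow> complex \<Rightarrow> 'v \<Rightarrow> 'v \<Rightarrow> real \<Rightarrow> bool" where
  "revival \<Gamma> \<alpha> \<beta> u v t \<longleftrightarrow>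
     u \<in> fst \<Gamma> \<and> v \<in> fst \<Gamma> \<and> u \<noteq> v \<and>
     (\<forall>w\<in>fst \<Gamma>. mat_vec (fst \<Gamma>) (transition_matrix \<Gamma> t) (unit_vec u) w
                   = \<alpha> * unit_vec u w + \<beta> * unit_vec v w) \<and>
     (norm \<alpha>)\<^sup>2 + (norm \<beta>)\<^sup>2 = 1"

text \<open>Orientation of the third kind of edges: \<open>(g,1)\<close> is adjacent to \<open>(h,0)\<close> iff \<open>g h\<inverse> \<in> S\<close>.\<close>

definition semi_cayley ::
  "('a, 'm) monoid_scheme \<Rightarrow> 'a set \<Rightarrow> 'a set \<Rightarrow> 'a set \<Rightarrow> ('a \<times> nat) graph" where
  "semi_cayley G R L S =
     (carrier G \<times> {0, 1},
      {{(g, 0), (h, 0)} | g h. g \<in> carrier G \<and> h \<in> carrier G \<and> h \<otimes>\<^bsub>G\<^esub> inv\<^bsub>G\<^esub> g \<in> R} \<union>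
      {{(g, 1), (h, 1)} | g h. g \<in> carrier G \<and> h \<in> carrier G \<and> h \<otimes>\<^bsub>G\<^esub> inv\<^bsub>G\<^esub> g \<in> L} \<union>
      {{(g, 0), (h, 1)} | g h. g \<in> carrier G \<and> h \<in> carrier G \<and> h \<otimes>\<^bsub>G\<^esub> inv\<^bsub>G\<^esub> g \<in> S})"

text \<open>The identification of \<open>G\<close> with \<open>\<int>\<^bsub>m 0\<^esub> \<times> \<dots> \<times> \<int>\<^bsub>m (r-1)\<^esub>\<close> is an isomorphism \<open>\<phi>\<close>; the
  \<open>s\<close>-th coordinate of \<open>g\<close> is \<open>\<phi> g s\<close>, an integer in \<open>{0..<m s}\<close>.\<close>

definition cyclic_product :: "nat \<Rightarrow> (nat \<Rightarrow> nat) \<Rightarrow> (nat \<Rightarrow> int) monoid" where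
  "cyclic_product r m = product_group {..<r} (\<lambda>s. integer_mod_group (m s))"

definition root_unity :: "nat \<Rightarrow> complex" where
  "root_unity k = exp (2 * complex_of_real pi * \<i> / of_nat k)"

definition chi :: "nat \<Rightarrow> (nat \<Rightarrow> nat) \<Rightarrow> ('a \<Rightarrow> nat \<Rightarrow> int) \<Rightarrow> 'a \<Rightarrow> 'a \<Rightarrow> complex" where
  "chi r m \<phi> z g = (\<Prod>s<r. root_unity (m s) powi (\<phi> z s * \<phi> g s))"

text \<open>In the remaining definitions \<open>ch z g\<close> stands for \<open>\<chi>\<^sub>z(g)\<close>.\<close>

definition chi_sum :: "('a \<Rightarrow> 'a \<Rightarrow> complex) \<Rightarrow> 'a \<Rightarrow> 'a set \<Rightarrow> complex" where
  "chi_sum ch z Y = (\<Sum>y\<in>Y. ch z y)"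

text \<open>For inverse-closed \<open>R\<close> and \<open>L\<close> the values of \<open>x_diff\<close> are real, so \<open>csqrt\<close> below is applied
  to a nonnegative real and is the usual square root.\<close>

definition x_diff :: "('a \<Rightarrow> 'a \<Rightarrow> complex) \<Rightarrow> 'a set \<Rightarrow> 'a set \<Rightarrow> 'a \<Rightarrow> complex" where
  "x_diff ch R L z = chi_sum ch z R - chi_sum ch z L"

definition D_root :: "('a \<Rightarrow> 'a \<Rightarrow> complex) \<Rightarrow> 'a set \<Rightarrow> 'a set \<Rightarrow> 'a set \<Rightarrow> 'a \<Rightarrow> complex" where
  "D_root ch R L S z =
     csqrt ((x_diff ch R L z)\<^sup>2 + 4 * (complex_of_real (norm (chi_sum ch z S)))\<^sup>2)"

definition lambda_plus :: "('a \<Rightarrow> 'a \<Rightarrow> complex) \<Rightarrow> 'a set \<Rightarrow> 'a set \<Rightarrow> 'a set \<Rightarrow> 'a \<Rightarrow> complex" where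
  "lambda_plus ch R L S z = (chi_sum ch z R + chi_sum ch z L + D_root ch R L S z) / 2"

definition lambda_minus :: "('a \<Rightarrow> 'a \<Rightarrow> complex) \<Rightarrow> 'a set \<Rightarrow> 'a set \<Rightarrow> 'a set \<Rightarrow> 'a \<Rightarrow> complex" where
  "lambda_minus ch R L S z = (chi_sum ch z R + chi_sum ch z L - D_root ch R L S z) / 2"

definition d_plus :: "('a \<Rightarrow> 'a \<Rightarrow> complex) \<Rightarrow> 'a set \<Rightarrow> 'a set \<Rightarrow> 'a set \<Rightarrow> 'a \<Rightarrow> real" where
  "d_plus ch R L S z =
     4 * (norm (chi_sum ch z S))\<^sup>2 /
     ((norm (x_diff ch R L z + D_root ch R L S z))\<^sup>2 + 4 * (norm (chi_sum ch z S))\<^sup>2)"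

definition d_minus :: "('a \<Rightarrow> 'a \<Rightarrow> complex) \<Rightarrow> 'a set \<Rightarrow> 'a set \<Rightarrow> 'a set \<Rightarrow> 'a \<Rightarrow> real" where
  "d_minus ch R L S z =
     4 * (norm (chi_sum ch z S))\<^sup>2 /
     ((norm (x_diff ch R L z - D_root ch R L S z))\<^sup>2 + 4 * (norm (chi_sum ch z S))\<^sup>2)"

definition e_plus :: "('a \<Rightarrow> 'a \<Rightarrow> complex) \<Rightarrow> 'a set \<Rightarrow> 'a set \<Rightarrow> 'a set \<Rightarrow> 'a \<Rightarrow> complex" where
  "e_plus ch R L S z =
     2 * chi_sum ch z S * (x_diff ch R L z + D_root ch R L S z) /
     complex_of_real
       ((norm (x_diff ch R L z + D_root ch R L S z))\<^sup>2 + 4 * (norm (chi_sum ch z S))\<^sup>2)"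

end

theory Submission
  imports Defs
begin

text \<open>For each \<open>z\<close>, the span of the two functions equal to \<open>\<chi>\<^sub>z\<close> conjugated on one layer and \<open>0\<close> on the
  other is invariant under the adjacency matrix, which acts there as the Hermitian matrix with
  diagonal \<open>\<chi>\<^sub>z(R), \<chi>\<^sub>z(L)\<close> and off-diagonal entry \<open>\<chi>\<^sub>z(S)\<close>. Pairing its eigenvectors with the column
  \<open>H(t) e\<^sub>u\<close> turns the revival equation into two scalar equations for each \<open>z\<close>, and by Fourier
  inversion nothing is lost. If \<open>\<chi>\<^sub>z(S) = 0\<close> the two layers decouple, which excludes \<open>\<beta> \<noteq> 0\<close>.
  Otherwise the scalar equations have \<open>\<chi>\<^sub>a(z) / \<chi>\<^sub>z(S)\<close> where (b) has its complex conjugate. These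
  agree because \<open>z\<close> and its inverse have the same eigenvalues. Conversely, the normalisation of
  \<open>\<alpha>\<close> and \<open>\<beta>\<close> follows from the eigenvalues being real.\<close>

section \<open>Exponentials and left eigenvectors\<close>

text \<open>Since \<open>mat_pow\<close> multiplies by \<open>M\<close> on the left, a left
  eigenvector absorbs one factor at a time and picks up \<open>\<mu>\<close> at each step. Pairing
  with the column \<open>u\<close> is a finite sum, so it may be exchanged with the exponential
  series.\<close>

lemma mat_exp_left_eigenvector:
  assumes V: "finite V" and u: "u \<in> V"
    and eigen: "\<And>v. v \<in> V \<Longrightarrow> (\<Sum>w\<in>V. \<psi> w * M w v) = \<mu> * \<psi> v"
  shows "(\<Sum>w\<in>V. \<psi> w * mat_exp V M w u) = exp \<mu> * \<psi> u"
proof -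
  have pow: "(\<Sum>w\<in>V. \<psi> w * mat_pow V M k w u) = \<mu> ^ k * \<psi> u" for k
  proof (induction k)
    case 0
    then show ?case using V u by (simp add: if_distrib cong: if_cong)
  next
    case (Suc k)
    have "(\<Sum>w\<in>V. \<psi> w * mat_pow V M (Suc k) w u)
        = (\<Sum>w\<in>V. \<Sum>v\<in>V. \<psi> w * M w v * mat_pow V M k v u)"
      by (simp add: mat_mul_def sum_distrib_left mult.assoc)
    also have "\<dots> = (\<Sum>v\<in>V. (\<Sum>w\<in>V. \<psi> w * M w v) * mat_pow V M k v u)"
      by (subst sum.swap) (simp add: sum_distrib_right)
    also have "\<dots> = \<mu> * (\<Sum>v\<in>V. \<psi> v * mat_pow V M k v u)"
      by (simp add: eigen sum_distrib_left mult.assoc)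
    finally show ?case by (simp add: Suc.IH)
  qed
  have "(\<lambda>k. \<Sum>w\<in>V. \<psi> w * (mat_pow V M k w u / fact k)) sums
      (\<Sum>w\<in>V. \<psi> w * mat_exp V M w u)"
    unfolding mat_exp_def
    by (intro sums_sum sums_mult summable_sums mat_exp_summable V u)
  moreover have "(\<Sum>w\<in>V. \<psi> w * (mat_pow V M k w u / fact k)) = \<psi> u * (\<mu> ^ k / fact k)" for k
    using pow[of k] by (simp add: sum_divide_distrib[symmetric])
  moreover have "(\<lambda>k. \<psi> u * (\<mu> ^ k / fact k)) sums (\<psi> u * exp \<mu>)"
    using exp_converges[of \<mu>] by (intro sums_mult) (simp add: scaleR_conv_of_real field_simps)
  ultimately show ?thesis
    by (simp add: sums_unique2 mult.commute)
qed

lemma transition_left_eigenvector: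
  assumes "finite (fst \<Gamma>)" "u \<in> fst \<Gamma>"
    and eigen: "\<And>v. v \<in> fst \<Gamma> \<Longrightarrow> (\<Sum>w\<in>fst \<Gamma>. \<psi> w * adjacency_matrix \<Gamma> w v) = \<mu> * \<psi> v"
  shows "(\<Sum>w\<in>fst \<Gamma>. \<psi> w * transition_matrix \<Gamma> t w u) = exp (\<i> * of_real t * \<mu>) * \<psi> u"
  unfolding transition_matrix_def
proof (rule mat_exp_left_eigenvector)
  fix v assume v: "v \<in> fst \<Gamma>"
  have "(\<Sum>w\<in>fst \<Gamma>. \<psi> w * (\<i> * of_real t * adjacency_matrix \<Gamma> w v))
      = \<i> * of_real t * (\<Sum>w\<in>fst \<Gamma>. \<psi> w * adjacency_matrix \<Gamma> w v)"
    by (simp add: sum_distrib_left mult_ac)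
  then show "(\<Sum>w\<in>fst \<Gamma>. \<psi> w * (\<i> * of_real t * adjacency_matrix \<Gamma> w v))
      = \<i> * of_real t * \<mu> * \<psi> v"
    by (simp add: eigen[OF v])
qed (use assms in auto)

lemma mat_vec_unit_vec:
  "finite V \<Longrightarrow> u \<in> V \<Longrightarrow> mat_vec V M (unit_vec u) w = M w u"
  by (simp add: mat_vec_def unit_vec_def if_distrib cong: if_cong)

section \<open>Fourier analysis for a nondegenerate bicharacter\<close>

text \<open>The Fourier arguments use only these properties of the pairing of \<open>G\<close> with
  itself; the coordinates of the cyclic factors enter only through \<open>bicharacter_chi\<close>.
  By symmetry, multiplicativity in the second argument gives it in the first.\<close>

locale bicharacter = comm_group G for G (structure) +
  fixes ch :: "'a \<Rightarrow> 'a \<Rightarrow> complex"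
  assumes fin: "finite (carrier G)"
    and sym: "ch z x = ch x z"
    and mult: "z \<in> carrier G \<Longrightarrow> x \<in> carrier G \<Longrightarrow> y \<in> carrier G \<Longrightarrow>
      ch z (x \<otimes> y) = ch z x * ch z y"
    and norm_ch [simp]: "norm (ch z x) = 1"
    and nondegenerate: "x \<in> carrier G \<Longrightarrow> x \<noteq> \<one> \<Longrightarrow> \<exists>z\<in>carrier G. ch z x \<noteq> 1"
begin

lemma ch_nonzero [simp]: "ch z x \<noteq> 0"
  using norm_ch[of z x] by fastforce

lemma ch_cnj [simp]: "ch z x * cnj (ch z x) = 1" "cnj (ch z x) * ch z x = 1"
  using complex_norm_square[of "ch z x"] by (simp_all add: mult.commute)

lemma ch_one [simp]: "z \<in> carrier G \<Longrightarrow> ch z \<one> = 1"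
  using mult[of z \<one> \<one>] by simp

lemma ch_inv [simp]: "z \<in> carrier G \<Longrightarrow> x \<in> carrier G \<Longrightarrow> ch z (inv x) = cnj (ch z x)"
proof -
  assume zx: "z \<in> carrier G" "x \<in> carrier G"
  have "ch z x * ch z (inv x) = ch z x * cnj (ch z x)"
    using mult[of z x "inv x"] zx by simp
  then show ?thesis by (simp del: ch_cnj)
qed

lemma ch_inv_left [simp]: "z \<in> carrier G \<Longrightarrow> x \<in> carrier G \<Longrightarrow> ch (inv z) x = cnj (ch z x)"
  using ch_inv[of x z] sym by metis

text \<open>Translating the summation variable by some \<open>w\<close> with
  \<open>ch w x \<noteq> 1\<close> multiplies the sum by \<open>ch w x\<close>, so the sum must
  vanish.\<close>

lemma orthogonality:
  assumes x: "x \<in> carrier G"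
  shows "(\<Sum>z\<in>carrier G. ch z x) = (if x = \<one> then of_nat (card (carrier G)) else 0)"
proof (cases "x = \<one>")
  case True
  then show ?thesis by simp
next
  case False
  then obtain w where w: "w \<in> carrier G" "ch w x \<noteq> 1"
    using nondegenerate x by blast
  have "(\<Sum>z\<in>carrier G. ch z x) = (\<Sum>z\<in>carrier G. ch (w \<otimes> z) x)"
    by (rule sum.reindex_bij_witness[where i = "\<lambda>z. w \<otimes> z" and j = "\<lambda>z. inv w \<otimes> z"])
      (use w in \<open>auto simp: m_assoc[symmetric]\<close>)
  also have "\<dots> = ch w x * (\<Sum>z\<in>carrier G. ch z x)"
    unfolding sum_distrib_left using w x mult sym by (intro sum.cong) metis+
  finally show ?thesis using False w(2) by simp
qed

text \<open>Fourier inversion: weighting the coefficients by \<open>ch z y\<close> and summing over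
  \<open>z\<close> isolates the order of the group times \<open>f y\<close>, by
  orthogonality.\<close>

lemma fourier_injective:
  assumes F: "\<And>z. z \<in> carrier G \<Longrightarrow> (\<Sum>x\<in>carrier G. cnj (ch z x) * f x) = 0"
    and y: "y \<in> carrier G"
  shows "f y = 0"
proof -
  have "0 = (\<Sum>z\<in>carrier G. ch z y * (\<Sum>x\<in>carrier G. cnj (ch z x) * f x))"
    by (simp add: F)
  also have "\<dots> = (\<Sum>x\<in>carrier G. (\<Sum>z\<in>carrier G. ch z (y \<otimes> inv x)) * f x)"
    unfolding sum_distrib_left sum_distrib_right
    by (subst sum.swap) (use y in \<open>auto intro!: sum.cong simp: mult mult_ac\<close>)
  also have "\<dots> = (\<Sum>x\<in>carrier G. if x = y then of_nat (card (carrier G)) * f x else 0)"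
  proof (rule sum.cong)
    fix x assume x: "x \<in> carrier G"
    have "y \<otimes> inv x = \<one> \<longleftrightarrow> x = y"
      using x y by (metis inv_equality inv_inv inv_closed r_inv)
    then show "(\<Sum>z\<in>carrier G. ch z (y \<otimes> inv x)) * f x
        = (if x = y then of_nat (card (carrier G)) * f x else 0)"
      using x y by (simp add: orthogonality)
  qed simp
  also have "\<dots> = of_nat (card (carrier G)) * f y"
    using fin y by simp
  finally show ?thesis using fin y by auto
qed

section \<open>Character sums over subsets and convolution with indicator functions\<close>

lemma chi_sum_inv:
  assumes "z \<in> carrier G" "Y \<subseteq> carrier G"
  shows "chi_sum ch (inv z) Y = cnj (chi_sum ch z Y)"
  unfolding chi_sum_def cnj_sum using assms by (intro sum.cong) auto

lemma chi_sum_real: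
  assumes z: "z \<in> carrier G" and Y: "Y \<subseteq> carrier G" "Y = set_inv Y"
  shows "cnj (chi_sum ch z Y) = chi_sum ch z Y"
proof -
  have closed: "inv y \<in> Y" if "y \<in> Y" for y
    using that Y(2) by (auto simp: SET_INV_def)
  have "cnj (chi_sum ch z Y) = (\<Sum>y\<in>Y. ch z (inv y))"
    unfolding chi_sum_def cnj_sum using z Y(1) by (intro sum.cong) auto
  also have "\<dots> = chi_sum ch z Y"
    unfolding chi_sum_def
    by (rule sum.reindex_bij_witness[where i = "\<lambda>y. inv y" and j = "\<lambda>y. inv y"])
      (use closed Y(1) in auto)
  finally show ?thesis .
qed

text \<open>Substitute \<open>s = y \<otimes> inv x\<close>. Then
  \<open>x = inv s \<otimes> y\<close>, and the inverse undoes the conjugation on the factor from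
  \<open>s\<close>. In \<open>convolution_left\<close> the substitution is
  \<open>x = s \<otimes> y\<close> and the conjugation stays. This is how the two off-diagonal
  entries of the 2 by 2 matrix come to be conjugate.\<close>

lemma convolution_right:
  assumes z: "z \<in> carrier G" and y: "y \<in> carrier G" and Y: "Y \<subseteq> carrier G"
  shows "(\<Sum>x\<in>carrier G. cnj (ch z x) * (if y \<otimes> inv x \<in> Y then 1 else 0))
    = cnj (ch z y) * chi_sum ch z Y"
proof -
  have cancel: "y \<otimes> (inv y \<otimes> x) = x" "inv (y \<otimes> inv x) \<otimes> y = x" "inv (inv x \<otimes> y) = inv y \<otimes> x"
    "y \<otimes> inv (inv x \<otimes> y) = x"
    if "x \<in> carrier G" for x
    using that y by (simp_all add: inv_mult_group m_assoc[symmetric] m_comm[of x] m_assoc)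
  have "(\<Sum>x\<in>carrier G. cnj (ch z x) * (if y \<otimes> inv x \<in> Y then 1 else 0))
      = (\<Sum>x\<in>{x \<in> carrier G. y \<otimes> inv x \<in> Y}. cnj (ch z x))"
    by (rule sum.mono_neutral_cong_right) (use fin in auto)
  also have "\<dots> = (\<Sum>s\<in>Y. cnj (ch z y) * ch z s)"
    by (rule sum.reindex_bij_witness[where i = "\<lambda>s. inv s \<otimes> y" and j = "\<lambda>x. y \<otimes> inv x"])
      (use z y Y cancel in \<open>auto simp: mult inv_mult_group subset_iff simp flip: mult.assoc\<close>)
  finally show ?thesis by (simp add: chi_sum_def sum_distrib_left)
qed

lemma convolution_left:
  assumes z: "z \<in> carrier G" and y: "y \<in> carrier G" and Y: "Y \<subseteq> carrier G"
  shows "(\<Sum>x\<in>carrier G. cnj (ch z x) * (if x \<otimes> inv y \<in> Y then 1 else 0))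
    = cnj (ch z y) * cnj (chi_sum ch z Y)"
proof -
  have "(\<Sum>x\<in>carrier G. cnj (ch z x) * (if x \<otimes> inv y \<in> Y then 1 else 0))
      = (\<Sum>x\<in>{x \<in> carrier G. x \<otimes> inv y \<in> Y}. cnj (ch z x))"
    by (rule sum.mono_neutral_cong_right) (use fin in auto)
  also have "\<dots> = (\<Sum>s\<in>Y. cnj (ch z y) * cnj (ch z s))"
    by (rule sum.reindex_bij_witness[where i = "\<lambda>s. s \<otimes> y" and j = "\<lambda>x. x \<otimes> inv y"])
      (use z y Y in \<open>auto simp: mult m_assoc subset_iff\<close>)
  finally show ?thesis by (simp add: chi_sum_def sum_distrib_left)
qed

end

section \<open>Roots of unity and the characters of a product of cyclic groups\<close>

lemma root_unity_powi: "root_unity k powi j = cis (of_int j * (2 * pi / of_nat k))"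
proof -
  have "root_unity k = cis (2 * pi / of_nat k)"
    by (simp add: root_unity_def cis_conv_exp mult_ac)
  then show ?thesis by (simp add: cis_power_int)
qed

text \<open>Coordinates of a product in \<open>G\<close> are reduced modulo the order of the factor;
  this removes the reduction inside exponents.\<close>

lemma root_unity_powi_mod:
  assumes "k > 0"
  shows "root_unity k powi (i * (j mod int k)) = root_unity k powi (i * j)"
proof -
  have nz: "root_unity k \<noteq> 0" by (simp add: root_unity_def)
  have one: "root_unity k powi (int k * l) = 1" for l
    using cis_multiple_2pi[of "of_int l"] assms by (simp add: root_unity_powi mult_ac)
  have "i * j = i * (j mod int k) + int k * (i * (j div int k))"
    by (metis distrib_left mult.left_commute mult_div_mod_eq add.commute)
  then show ?thesis by (simp add: power_int_add nz one)
qed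

lemma root_unity_powi_ne_1:
  assumes "0 < j" "j < int k"
  shows "root_unity k powi j \<noteq> 1"
proof
  assume "root_unity k powi j = 1"
  then have "cos (of_int j * (2 * pi / of_nat k)) = 1"
    unfolding root_unity_powi by (metis Re_complex_of_real cis.sel(1) of_real_1)
  then obtain l :: int where "of_int j * (2 * pi / of_nat k) = of_int l * 2 * pi"
    using cos_one_2pi_int by blast
  moreover have "real k > 0" using assms by simp
  ultimately have "real_of_int j = of_int l * of_nat k" by (simp add: field_simps)
  then have "j = l * int k" by (metis of_int_eq_iff of_int_mult of_int_of_nat_eq)
  then show False
    using assms zdvd_not_zless[of j "int k"] by simp
qed

text \<open>Only nondegeneracy needs an idea: if \<open>x\<close> has a nonzero coordinate, pair it
  with the element whose only nonzero coordinate is a 1 at the same place.\<close>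

lemma bicharacter_chi:
  fixes G (structure)
  assumes G: "comm_group G" "finite (carrier G)"
    and m: "\<And>s. s < r \<Longrightarrow> m s > 0"
    and iso: "\<phi> \<in> iso G (cyclic_product r m)"
  shows "bicharacter G (chi r m \<phi>)"
proof -
  interpret comm_group G by fact
  have hom: "\<phi> \<in> hom G (cyclic_product r m)" and bij: "bij_betw \<phi> (carrier G) (carrier (cyclic_product r m))"
    using iso by (auto simp: iso_def)
  have group: "group (cyclic_product r m)"
    unfolding cyclic_product_def by simp
  have phi_mult: "\<phi> (x \<otimes> y) s = (\<phi> x s + \<phi> y s) mod int (m s)"
    if "x \<in> carrier G" "y \<in> carrier G" "s < r" for x y s
    using hom_mult[OF hom that(1,2)] that(3) by (simp add: cyclic_product_def)
  show ?thesis
  proof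
    show "finite (carrier G)" by fact
    show "chi r m \<phi> z x = chi r m \<phi> x z" for z x
      by (simp add: chi_def mult.commute)
    show "norm (chi r m \<phi> z x) = 1" for z x
      by (simp add: chi_def prod_norm[symmetric] root_unity_powi)
    show "chi r m \<phi> z (x \<otimes> y) = chi r m \<phi> z x * chi r m \<phi> z y"
      if "z \<in> carrier G" "x \<in> carrier G" "y \<in> carrier G" for x y z
      unfolding chi_def prod.distrib[symmetric]
    proof (rule prod.cong)
      fix s assume s: "s \<in> {..<r}"
      have "root_unity (m s) \<noteq> 0" by (simp add: root_unity_def)
      then show "root_unity (m s) powi (\<phi> z s * \<phi> (x \<otimes> y) s)
          = root_unity (m s) powi (\<phi> z s * \<phi> x s) * root_unity (m s) powi (\<phi> z s * \<phi> y s)"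
        using s that m[of s]
        by (simp add: phi_mult root_unity_powi_mod distrib_left power_int_add)
    qed simp
    show "\<exists>z\<in>carrier G. chi r m \<phi> z x \<noteq> 1" if x: "x \<in> carrier G" "x \<noteq> \<one>" for x
    proof -
      \<comment> \<open>Positivity of \<open>m s\<close> matters here:
        \<open>integer_mod_group 0\<close> is the group of all integers.\<close>
      have car: "carrier (cyclic_product r m) = (\<Pi>\<^sub>E s\<in>{..<r}. {0..<int (m s)})"
        unfolding cyclic_product_def carrier_product_group
        by (rule PiE_cong) (simp add: carrier_integer_mod_group m less_imp_neq)
      have phi_x: "\<phi> x \<in> (\<Pi>\<^sub>E s\<in>{..<r}. {0..<int (m s)})"
        using hom_in_carrier[OF hom x(1)] unfolding car .
      have "\<phi> x \<noteq> \<phi> \<one>"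
        using bij x by (meson bij_betw_imp_inj_on inj_on_eq_iff one_closed)
      moreover have "\<phi> \<one> = (\<lambda>s\<in>{..<r}. 0)"
        using hom_one[OF hom is_group group] by (simp add: cyclic_product_def)
      ultimately obtain s where s: "s < r" "\<phi> x s \<noteq> 0"
        using phi_x by (metis (no_types, lifting) PiE_restrict restrict_ext lessThan_iff)
      have bounds: "0 < \<phi> x s" "\<phi> x s < int (m s)"
        using phi_x s by (auto simp: PiE_iff order_less_le)
      \<comment> \<open>The unit vector at \<open>s\<close>. It lies in the product because a
        nonzero reduced coordinate at \<open>s\<close> forces \<open>m s\<close> to be at least
        2.\<close>
      define \<delta> where "\<delta> = (\<lambda>i\<in>{..<r}. if i = s then 1 else 0 :: int)"
      have "\<delta> \<in> carrier (cyclic_product r m)"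
        unfolding car \<delta>_def using bounds m by auto
      then obtain z where z: "z \<in> carrier G" "\<phi> z = \<delta>"
        using bij by (metis bij_betw_imp_surj_on imageE)
      have "chi r m \<phi> z x = (\<Prod>i<r. if i = s then root_unity (m s) powi \<phi> x s else 1)"
        unfolding chi_def z(2) \<delta>_def by (rule prod.cong) auto
      also have "\<dots> = root_unity (m s) powi \<phi> x s"
        using s(1) by simp
      finally show ?thesis
        using root_unity_powi_ne_1[OF bounds] z(1) by (intro bexI[of _ z]) simp_all
    qed
  qed
qed

section \<open>Left eigenvectors of a semi-Cayley graph\<close>

locale semi_cayley_bicharacter = bicharacter +
  fixes R L S :: "'a set"
  assumes sub: "R \<subseteq> carrier G" "L \<subseteq> carrier G" "S \<subseteq> carrier G"
    and set_inv: "R = set_inv R" "L = set_inv L"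
begin

abbreviation \<Gamma> :: "('a \<times> nat) graph" where "\<Gamma> \<equiv> semi_cayley G R L S"

lemma fst_\<Gamma>: "fst \<Gamma> = carrier G \<times> {0, 1}"
  by (simp add: semi_cayley_def)

lemma finite_\<Gamma>: "finite (fst \<Gamma>)"
  by (simp add: fst_\<Gamma> fin)

lemma sum_\<Gamma>: "(\<Sum>w\<in>fst \<Gamma>. f w) = (\<Sum>x\<in>carrier G. f (x, 0)) + (\<Sum>x\<in>carrier G. f (x, 1))"
  unfolding fst_\<Gamma> using sum.cartesian_product[of "\<lambda>x i. f (x, i)" "{0, 1}" "carrier G"]
  by (simp add: sum.distrib)

lemma diff_mem_iff:
  assumes "Y \<subseteq> carrier G" "Y = set_inv Y" "x \<in> carrier G" "y \<in> carrier G"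
  shows "x \<otimes> inv y \<in> Y \<longleftrightarrow> y \<otimes> inv x \<in> Y"
proof -
  have closed: "inv y \<in> Y" if "y \<in> Y" for y
    using that assms(2) by (auto simp: SET_INV_def)
  have "inv (x \<otimes> inv y) = y \<otimes> inv x" "inv (y \<otimes> inv x) = x \<otimes> inv y"
    using assms by (simp_all add: inv_mult_group)
  then show ?thesis using closed by metis
qed

text \<open>Edges are unordered, so within a layer either order of the endpoints may witness an
  edge; \<open>diff_mem_iff\<close> makes both tests agree. Between layers the order of the quotient
  is fixed by which endpoint lies in layer 1, and \<open>S\<close> may be any subset.\<close>

lemma adjacency:
  assumes "x \<in> carrier G" "y \<in> carrier G"
  shows "adjacency_matrix \<Gamma> (x, 0) (y, 0) = (if x \<otimes> inv y \<in> R then 1 else 0)"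
    and "adjacency_matrix \<Gamma> (x, 1) (y, 1) = (if x \<otimes> inv y \<in> L then 1 else 0)"
    and "adjacency_matrix \<Gamma> (x, 1) (y, 0) = (if x \<otimes> inv y \<in> S then 1 else 0)"
    and "adjacency_matrix \<Gamma> (x, 0) (y, 1) = (if y \<otimes> inv x \<in> S then 1 else 0)"
  using assms diff_mem_iff[of R x y] diff_mem_iff[of L x y] sub set_inv
  by (auto simp: adjacency_matrix_def semi_cayley_def doubleton_eq_iff)

definition wave :: "'a \<Rightarrow> complex \<Rightarrow> complex \<Rightarrow> 'a \<times> nat \<Rightarrow> complex" where
  "wave z p q = (\<lambda>(x, i). cnj (ch z x) * (if i = 0 then p else q))"

text \<open>The assumptions on \<open>p\<close> and \<open>q\<close> say that the row
  \<open>(p, q)\<close> is a left eigenvector of the 2 by 2 matrix with first row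
  \<open>chi_sum ch z R\<close>, \<open>chi_sum ch z S\<close> and second row
  \<open>cnj (chi_sum ch z S)\<close>, \<open>chi_sum ch z L\<close>. The convolution lemmas reduce
  the adjacency matrix to it.\<close>

lemma wave_adjacency:
  assumes z: "z \<in> carrier G"
    and eig0: "p * chi_sum ch z R + q * cnj (chi_sum ch z S) = \<mu> * p"
    and eig1: "p * chi_sum ch z S + q * chi_sum ch z L = \<mu> * q"
    and v: "v \<in> fst \<Gamma>"
  shows "(\<Sum>w\<in>fst \<Gamma>. wave z p q w * adjacency_matrix \<Gamma> w v) = \<mu> * wave z p q v"
proof -
  obtain y i where y: "v = (y, i)" "y \<in> carrier G" "i \<in> {0, 1}"
    using v by (auto simp: fst_\<Gamma>)
  have pull: "(\<Sum>x\<in>carrier G. cnj (ch z x) * c * f x) = c * (\<Sum>x\<in>carrier G. cnj (ch z x) * f x)"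
    for c and f :: "'a \<Rightarrow> complex"
    by (simp add: sum_distrib_left mult_ac)
  note conv = convolution_left[OF z y(2)] convolution_right[OF z y(2)]
  show ?thesis
  proof (cases "i = 0")
    case True
    have "(\<Sum>w\<in>fst \<Gamma>. wave z p q w * adjacency_matrix \<Gamma> w v)
        = p * (\<Sum>x\<in>carrier G. cnj (ch z x) * (if x \<otimes> inv y \<in> R then 1 else 0))
          + q * (\<Sum>x\<in>carrier G. cnj (ch z x) * (if x \<otimes> inv y \<in> S then 1 else 0))"
      unfolding sum_\<Gamma> by (simp add: wave_def y True adjacency pull[symmetric] del: One_nat_def cong: sum.cong)
    also have "\<dots> = cnj (ch z y) * (p * chi_sum ch z R + q * cnj (chi_sum ch z S))"
      using sub set_inv by (simp add: conv chi_sum_real[OF z] algebra_simps)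
    finally show ?thesis
      unfolding eig0 by (simp add: wave_def y True)
  next
    case False
    then have i: "i = 1" using y by auto
    have "(\<Sum>w\<in>fst \<Gamma>. wave z p q w * adjacency_matrix \<Gamma> w v)
        = p * (\<Sum>x\<in>carrier G. cnj (ch z x) * (if y \<otimes> inv x \<in> S then 1 else 0))
          + q * (\<Sum>x\<in>carrier G. cnj (ch z x) * (if x \<otimes> inv y \<in> L then 1 else 0))"
      unfolding sum_\<Gamma> by (simp add: wave_def y i adjacency pull[symmetric] del: One_nat_def cong: sum.cong)
    also have "\<dots> = cnj (ch z y) * (p * chi_sum ch z S + q * chi_sum ch z L)"
      using sub set_inv by (simp add: conv chi_sum_real[OF z] algebra_simps)
    finally show ?thesis
      unfolding eig1 by (simp add: wave_def y i)
  qed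
qed

lemma wave_transition:
  assumes "z \<in> carrier G" "u \<in> fst \<Gamma>"
    and "p * chi_sum ch z R + q * cnj (chi_sum ch z S) = \<mu> * p"
    and "p * chi_sum ch z S + q * chi_sum ch z L = \<mu> * q"
  shows "(\<Sum>w\<in>fst \<Gamma>. wave z p q w * transition_matrix \<Gamma> t w u)
    = exp (\<i> * of_real t * \<mu>) * wave z p q u"
  by (intro transition_left_eigenvector finite_\<Gamma> assms wave_adjacency)

section \<open>The spectral quantities\<close>

text \<open>Here \<open>gap\<close> and the following \<open>diff\<close> are the square root
  \<open>D_root\<close> and the difference \<open>x_diff\<close> as real numbers, so that order and
  division can be handled over the reals; see \<open>D_root_eq\<close> and
  \<open>x_diff_eq\<close>.\<close>

definition gap :: "'a \<Rightarrow> real" where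
  "gap z = sqrt ((Re (x_diff ch R L z))\<^sup>2 + 4 * (norm (chi_sum ch z S))\<^sup>2)"

definition diff :: "'a \<Rightarrow> real" where
  "diff z = Re (x_diff ch R L z)"

context
  fixes z assumes z: "z \<in> carrier G"
begin

lemma chi_sum_RL_real:
  "chi_sum ch z R = of_real (Re (chi_sum ch z R))"
  "chi_sum ch z L = of_real (Re (chi_sum ch z L))"
  using chi_sum_real[OF z sub(1) set_inv(1)] chi_sum_real[OF z sub(2) set_inv(2)]
  by (simp_all add: complex_eq_iff)

lemma x_diff_eq: "x_diff ch R L z = of_real (diff z)"
  unfolding diff_def x_diff_def using chi_sum_RL_real by (metis minus_complex.sel(1) of_real_diff)

lemma D_root_eq: "D_root ch R L S z = of_real (gap z)"
proof -
  have "D_root ch R L S z = csqrt (of_real ((diff z)\<^sup>2 + 4 * (norm (chi_sum ch z S))\<^sup>2))"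
    unfolding D_root_def x_diff_eq by simp
  also have "\<dots> = of_real (gap z)"
    unfolding gap_def diff_def[symmetric] by (rule csqrt_of_real) simp
  finally show ?thesis .
qed

text \<open>Measuring the eigenvalue from \<open>chi_sum ch z R\<close> leaves half of
  \<open>gap z - diff z\<close>, the shape that the layer 0 eigenvector equation requires.\<close>

lemma lambda_plus_eq:
  "lambda_plus ch R L S z = chi_sum ch z R + of_real (gap z - diff z) / 2"
  unfolding lambda_plus_def D_root_eq of_real_diff x_diff_eq[symmetric]
  by (simp add: x_diff_def field_simps)

lemma lambda_minus_eq:
  "lambda_minus ch R L S z = chi_sum ch z R - of_real (gap z + diff z) / 2"
  unfolding lambda_minus_def D_root_eq of_real_add x_diff_eq[symmetric]
  by (simp add: x_diff_def field_simps)

lemma norm_exp_lambda: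
  "norm (exp (\<i> * of_real t * lambda_plus ch R L S z)) = 1"
  "norm (exp (\<i> * of_real t * lambda_minus ch R L S z)) = 1"
  unfolding lambda_plus_eq lambda_minus_eq by (subst chi_sum_RL_real, simp)+

text \<open>The difference of squares behind all later cancellations: in \<open>d_plus\<close>,
  \<open>d_minus\<close> and \<open>e_plus\<close>, and in the eigenvector equations.\<close>

lemma gap_diff_product: "(gap z - diff z) * (gap z + diff z) = 4 * (norm (chi_sum ch z S))\<^sup>2"
proof -
  have "(gap z)\<^sup>2 = (diff z)\<^sup>2 + 4 * (norm (chi_sum ch z S))\<^sup>2"
    unfolding gap_def diff_def by simp
  then show ?thesis by (simp add: algebra_simps power2_eq_square)
qed

lemma gap_diff_product':
  "of_real (gap z - diff z) * of_real (gap z + diff z) = 4 * chi_sum ch z S * cnj (chi_sum ch z S)"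
  unfolding of_real_mult[symmetric] gap_diff_product
  by (simp add: complex_norm_square[symmetric] mult.assoc)

context
  assumes S: "chi_sum ch z S \<noteq> 0"
begin

lemma gap_diff_pos: "gap z - diff z > 0" "gap z + diff z > 0"
proof -
  have "\<bar>diff z\<bar> < gap z"
    unfolding gap_def diff_def[symmetric] using S
    by (metis add_strict_increasing2 order_refl real_sqrt_abs real_sqrt_less_mono less_add_same_cancel1
        zero_less_mult_iff zero_less_norm_iff zero_less_numeral zero_less_power)
  then show "gap z - diff z > 0" "gap z + diff z > 0" by auto
qed

lemma gap_pos: "gap z > 0"
  using gap_diff_pos by linarith

text \<open>With \<open>4 * (norm (chi_sum ch z S))\<^sup>2\<close> factored by
  \<open>gap_diff_product\<close>, the factor \<open>gap z - diff z\<close> cancels. The formulas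
  for \<open>d_plus\<close> and \<open>e_plus\<close> arise likewise by cancelling
  \<open>gap z + diff z\<close>.\<close>

lemma d_minus_eq: "d_minus ch R L S z = (gap z + diff z) / (2 * gap z)"
proof -
  have n: "(norm (x_diff ch R L z - D_root ch R L S z))\<^sup>2 = (gap z - diff z)\<^sup>2"
    unfolding x_diff_eq D_root_eq of_real_diff[symmetric] norm_of_real by (simp add: power2_commute)
  have den: "(gap z - diff z)\<^sup>2 + (gap z - diff z) * (gap z + diff z)
      = (gap z - diff z) * (2 * gap z)"
    by (simp add: algebra_simps power2_eq_square)
  show ?thesis
    unfolding d_minus_def n gap_diff_product[symmetric] den using gap_diff_pos gap_pos by simp
qed

lemma plus_denominator:
  "(norm (x_diff ch R L z + D_root ch R L S z))\<^sup>2 + 4 * (norm (chi_sum ch z S))\<^sup>2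
    = (2 * gap z) * (gap z + diff z)"
proof -
  have "(norm (x_diff ch R L z + D_root ch R L S z))\<^sup>2 = (gap z + diff z)\<^sup>2"
    unfolding x_diff_eq D_root_eq of_real_add[symmetric] norm_of_real by (simp add: add.commute)
  then show ?thesis
    unfolding gap_diff_product[symmetric] by (simp add: algebra_simps power2_eq_square)
qed

lemma d_plus_eq: "d_plus ch R L S z = (gap z - diff z) / (2 * gap z)"
  unfolding d_plus_def plus_denominator unfolding gap_diff_product[symmetric]
  using gap_diff_pos gap_pos by simp

lemma e_plus_eq: "e_plus ch R L S z = chi_sum ch z S / of_real (gap z)"
proof -
  have num: "x_diff ch R L z + D_root ch R L S z = of_real (gap z + diff z)"
    by (simp add: x_diff_eq D_root_eq)
  have "complex_of_real (gap z + diff z) \<noteq> 0" "complex_of_real (gap z) \<noteq> 0"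
    using gap_diff_pos gap_pos by (simp_all del: of_real_add)
  then show ?thesis
    unfolding e_plus_def plus_denominator unfolding num
    by (simp del: of_real_add)
qed

text \<open>The quotient of the simplified forms is \<open>gap z + diff z\<close> over twice the
  conjugate of \<open>chi_sum ch z S\<close>; \<open>gap_diff_product'\<close> moves the conjugate
  away and gives the coefficient in the shape that the eigenvectors produce, up to
  conjugation.\<close>

lemma d_minus_e_plus:
  "of_real (d_minus ch R L S z) * inverse (cnj (e_plus ch R L S z))
    = 2 * chi_sum ch z S / of_real (gap z - diff z)"
proof -
  have "complex_of_real (gap z - diff z) \<noteq> 0" "complex_of_real (gap z) \<noteq> 0"
    using gap_diff_pos gap_pos by (simp_all del: of_real_diff)
  then show ?thesis
    using gap_diff_product' S
    by (simp add: d_minus_eq e_plus_eq divide_simps del: of_real_diff of_real_add) (simp add: mult_ac)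
qed

lemma d_plus_e_plus:
  "of_real (d_plus ch R L S z) * inverse (cnj (e_plus ch R L S z))
    = 2 * chi_sum ch z S / of_real (gap z + diff z)"
proof -
  have "complex_of_real (gap z + diff z) \<noteq> 0" "complex_of_real (gap z) \<noteq> 0"
    using gap_diff_pos gap_pos by (simp_all del: of_real_add)
  then show ?thesis
    using gap_diff_product' S
    by (simp add: d_plus_eq e_plus_eq divide_simps del: of_real_diff of_real_add)
qed

end

end

section \<open>Revival as a pair of scalar equations for each character\<close>

text \<open>The defect of the column equation vanishes if and only if its pairings with all
  eigenvectors do: for each \<open>z\<close> the two eigenvectors are independent, so their pairings
  determine the Fourier coefficients on both layers.\<close>

lemma transition_column_iff:
  assumes g: "g \<in> carrier G" and h: "h \<in> carrier G"
    and S: "\<And>z. z \<in> carrier G \<Longrightarrow> chi_sum ch z S \<noteq> 0"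
  shows "(\<forall>w\<in>fst \<Gamma>. transition_matrix \<Gamma> t w (g, 1)
        = \<alpha> * unit_vec (g, 1) w + \<beta> * unit_vec (h, 0) w) \<longleftrightarrow>
    (\<forall>z\<in>carrier G.
      exp (\<i> * of_real t * lambda_plus ch R L S z)
        = \<alpha> + \<beta> * (2 * ch z (g \<otimes> inv h) * cnj (chi_sum ch z S) / of_real (gap z - diff z)) \<and>
      exp (\<i> * of_real t * lambda_minus ch R L S z)
        = \<alpha> - \<beta> * (2 * ch z (g \<otimes> inv h) * cnj (chi_sum ch z S) / of_real (gap z + diff z)))"
    (is "?L \<longleftrightarrow> (\<forall>z\<in>carrier G. ?P z)")
proof -
  define \<delta> where "\<delta> w = transition_matrix \<Gamma> t w (g, 1)
    - (\<alpha> * unit_vec (g, 1) w + \<beta> * unit_vec (h, 0) w)" for w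
  have V: "(g, 1) \<in> fst \<Gamma>" "(h, 0) \<in> fst \<Gamma>"
    using g h by (auto simp: fst_\<Gamma>)
  have sum_unit: "(\<Sum>w\<in>fst \<Gamma>. \<psi> w * unit_vec u w) = \<psi> u" if "u \<in> fst \<Gamma>" for \<psi> u
    using finite_\<Gamma> that by (simp add: unit_vec_def if_distrib cong: if_cong)
  \<comment> \<open>The weights \<open>(p, q)\<close> solve the layer 0 eigenvector equation for
    \<open>p = 2 * cnj (chi_sum ch z S)\<close>; the layer 1 equation then follows from
    \<open>gap_diff_product'\<close>.\<close>
  have plus: "(\<Sum>w\<in>fst \<Gamma>. wave z (2 * cnj (chi_sum ch z S)) (of_real (gap z - diff z)) w * \<delta> w) = 0 \<longleftrightarrow>
      exp (\<i> * of_real t * lambda_plus ch R L S z)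
        = \<alpha> + \<beta> * (2 * ch z (g \<otimes> inv h) * cnj (chi_sum ch z S) / of_real (gap z - diff z))"
    (is "?sum = 0 \<longleftrightarrow> ?E = _")
    and minus: "(\<Sum>w\<in>fst \<Gamma>. wave z (2 * cnj (chi_sum ch z S)) (- of_real (gap z + diff z)) w * \<delta> w) = 0 \<longleftrightarrow>
      exp (\<i> * of_real t * lambda_minus ch R L S z)
        = \<alpha> - \<beta> * (2 * ch z (g \<otimes> inv h) * cnj (chi_sum ch z S) / of_real (gap z + diff z))"
    (is "?sum' = 0 \<longleftrightarrow> ?E' = _")
    if z: "z \<in> carrier G" for z
  proof -
    let ?p = "2 * cnj (chi_sum ch z S)"
    let ?q = "of_real (gap z - diff z) :: complex" and ?q' = "- of_real (gap z + diff z) :: complex"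
    have L: "chi_sum ch z L = chi_sum ch z R - of_real (diff z)"
      using x_diff_eq[OF z] by (simp add: x_diff_def algebra_simps)
    \<comment> \<open>At \<open>(g, 1)\<close> only the weight \<open>q\<close> is seen, at
      \<open>(h, 0)\<close> only the weight \<open>p\<close>.\<close>
    have expand: "(\<Sum>w\<in>fst \<Gamma>. wave z p q w * \<delta> w)
        = (E - \<alpha>) * (cnj (ch z g) * q) - \<beta> * (cnj (ch z h) * p)"
      if "(\<Sum>w\<in>fst \<Gamma>. wave z p q w * transition_matrix \<Gamma> t w (g, 1)) = E * wave z p q (g, 1)"
      for p q E
    proof -
      have "(\<Sum>w\<in>fst \<Gamma>. wave z p q w * \<delta> w)
          = (\<Sum>w\<in>fst \<Gamma>. wave z p q w * transition_matrix \<Gamma> t w (g, 1))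
            - (\<alpha> * (\<Sum>w\<in>fst \<Gamma>. wave z p q w * unit_vec (g, 1) w)
               + \<beta> * (\<Sum>w\<in>fst \<Gamma>. wave z p q w * unit_vec (h, 0) w))"
        unfolding \<delta>_def
        by (simp add: sum_distrib_left sum_subtractf sum.distrib algebra_simps)
      then show ?thesis
        unfolding that sum_unit[OF V(1)] sum_unit[OF V(2)]
        by (simp add: wave_def algebra_simps)
    qed
    have prod: "?q * of_real (gap z + diff z) = 4 * chi_sum ch z S * cnj (chi_sum ch z S)"
      by (rule gap_diff_product'[OF z])
    have sum: "?sum = (?E - \<alpha>) * (cnj (ch z g) * ?q) - \<beta> * (cnj (ch z h) * ?p)"
      by (rule expand, rule wave_transition[OF z V(1)])
        (use prod in \<open>simp_all add: lambda_plus_eq[OF z] L field_simps\<close>)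
    have sum': "?sum' = (?E' - \<alpha>) * (cnj (ch z g) * ?q') - \<beta> * (cnj (ch z h) * ?p)"
      by (rule expand, rule wave_transition[OF z V(1)])
        (use prod in \<open>simp_all add: lambda_minus_eq[OF z] L field_simps\<close>)
    \<comment> \<open>Factoring out the phase of \<open>g\<close> leaves a dependence on
      \<open>g \<otimes> inv h\<close> alone.\<close>
    have chi: "cnj (ch z h) = cnj (ch z g) * ch z (g \<otimes> inv h)"
      using z g h by (simp add: mult mult.assoc[symmetric])
    have "?q \<noteq> 0" "?q' \<noteq> 0"
      using gap_diff_pos[OF z S[OF z]] by (simp_all del: of_real_diff of_real_add)
    then have *: "(E - \<alpha>) * (cnj (ch z g) * q) - \<beta> * (cnj (ch z h) * ?p) = 0 \<longleftrightarrow>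
        E = \<alpha> + \<beta> * (ch z (g \<otimes> inv h) * ?p / q)"
      if "q \<noteq> 0" for E q
    proof -
      have "(E - \<alpha>) * (cnj (ch z g) * q) - \<beta> * (cnj (ch z h) * ?p)
          = cnj (ch z g) * ((E - \<alpha>) * q - \<beta> * (ch z (g \<otimes> inv h) * ?p))"
        unfolding chi by (simp add: algebra_simps)
      also have "\<dots> = 0 \<longleftrightarrow> (E - \<alpha>) * q = \<beta> * (ch z (g \<otimes> inv h) * ?p)"
        by (simp del: mult_eq_0_iff add: mult_eq_0_iff[of "cnj (ch z g)"])
      also have "\<dots> \<longleftrightarrow> E - \<alpha> = \<beta> * (ch z (g \<otimes> inv h) * ?p / q)"
        using that by (simp add: eq_divide_eq)
      finally show ?thesis by (simp add: algebra_simps)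
    qed
    show "?sum = 0 \<longleftrightarrow> ?E = \<alpha> + \<beta> * (2 * ch z (g \<otimes> inv h) * cnj (chi_sum ch z S) / of_real (gap z - diff z))"
      unfolding sum *[OF \<open>?q \<noteq> 0\<close>] by (simp add: mult_ac)
    show "?sum' = 0 \<longleftrightarrow> ?E' = \<alpha> - \<beta> * (2 * ch z (g \<otimes> inv h) * cnj (chi_sum ch z S) / of_real (gap z + diff z))"
      unfolding sum' *[OF \<open>?q' \<noteq> 0\<close>] by (simp add: mult_ac del: of_real_add)
  qed
  have "?L \<longleftrightarrow> (\<forall>w\<in>fst \<Gamma>. \<delta> w = 0)"
    by (simp add: \<delta>_def)
  also have "\<dots> \<longleftrightarrow> (\<forall>z\<in>carrier G. ?P z)"
  proof
    assume "\<forall>w\<in>fst \<Gamma>. \<delta> w = 0"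
    then show "\<forall>z\<in>carrier G. ?P z"
      using plus minus by (simp del: of_real_add of_real_diff)
  next
    assume P: "\<forall>z\<in>carrier G. ?P z"
    have F: "(\<Sum>x\<in>carrier G. cnj (ch z x) * \<delta> (x, 0)) = 0 \<and> (\<Sum>x\<in>carrier G. cnj (ch z x) * \<delta> (x, 1)) = 0"
      (is "?F0 = 0 \<and> ?F1 = 0") if z: "z \<in> carrier G" for z
    proof -
      have wave: "(\<Sum>w\<in>fst \<Gamma>. wave z p q w * \<delta> w) = p * ?F0 + q * ?F1" for p q
        unfolding sum_\<Gamma> by (simp add: wave_def sum_distrib_left mult_ac)
      have 1: "2 * cnj (chi_sum ch z S) * ?F0 + of_real (gap z - diff z) * ?F1 = 0"
        and 2: "2 * cnj (chi_sum ch z S) * ?F0 + (- of_real (gap z + diff z)) * ?F1 = 0"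
        using P z plus[OF z] minus[OF z] unfolding wave by blast+
      \<comment> \<open>The eigenvectors share their layer 0 weight, so subtracting the pairings
        eliminates \<open>?F0\<close>.\<close>
      have "2 * of_real (gap z) * ?F1 = 0"
        using arg_cong2[OF 1 2, of "(-)"] by (simp add: algebra_simps)
      then have "?F1 = 0" using gap_pos[OF z S[OF z]] by simp
      with 1 S[OF z] show ?thesis by simp
    qed
    show "\<forall>w\<in>fst \<Gamma>. \<delta> w = 0"
    proof
      fix w assume "w \<in> fst \<Gamma>"
      then obtain y i where w: "w = (y, i)" "y \<in> carrier G" "i = 0 \<or> i = 1"
        by (auto simp: fst_\<Gamma>)
      show "\<delta> w = 0"
        using w(3) fourier_injective[OF _ w(2), of "\<lambda>x. \<delta> (x, i)"] F unfolding w(1) by blast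
    qed
  qed
  finally show ?thesis .
qed

text \<open>Where \<open>\<chi>\<^sub>z(S)\<close> vanishes, \<open>\<chi>\<^sub>z\<close> supported on layer \<open>0\<close> is itself a left eigenvector, so no
  amplitude can be transferred to that layer.\<close>

lemma transition_column_nonvanishing:
  assumes g: "g \<in> carrier G" and h: "h \<in> carrier G" and z: "z \<in> carrier G" and \<beta>: "\<beta> \<noteq> 0"
    and column: "\<forall>w\<in>fst \<Gamma>. transition_matrix \<Gamma> t w (g, 1)
        = \<alpha> * unit_vec (g, 1) w + \<beta> * unit_vec (h, 0) w"
  shows "chi_sum ch z S \<noteq> 0"
proof
  assume S: "chi_sum ch z S = 0"
  have V: "(g, 1) \<in> fst \<Gamma>" "(h, 0) \<in> fst \<Gamma>"
    using g h by (auto simp: fst_\<Gamma>)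
  \<comment> \<open>The wave vanishes at \<open>(g, 1)\<close>, and so does its pairing with that
    column; in the assumed form of the column only the term at \<open>(h, 0)\<close>
    survives.\<close>
  have "0 = (\<Sum>w\<in>fst \<Gamma>. wave z 1 0 w * transition_matrix \<Gamma> t w (g, 1))"
    using wave_transition[OF z V(1), of 1 0 "chi_sum ch z R"] S by (simp add: wave_def)
  also have "\<dots> = (\<Sum>w\<in>fst \<Gamma>. wave z 1 0 w * (\<beta> * unit_vec (h, 0) w))"
    by (rule sum.cong) (use column in \<open>auto simp: wave_def unit_vec_def\<close>)
  also have "\<dots> = \<beta> * cnj (ch z h)"
    using finite_\<Gamma> V(2) by (simp add: unit_vec_def wave_def if_distrib cong: if_cong)
  finally show False using \<beta> by simp
qed

text \<open>Passing from \<open>z\<close> to its inverse fixes the eigenvalues and conjugates the coefficient of \<open>\<beta>\<close>,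
  which is therefore real.\<close>

lemma revival_coefficient_real:
  assumes a: "a \<in> carrier G" and z: "z \<in> carrier G" and \<beta>: "\<beta> \<noteq> 0"
    and S: "\<And>z. z \<in> carrier G \<Longrightarrow> chi_sum ch z S \<noteq> 0"
    and plus: "\<And>z. z \<in> carrier G \<Longrightarrow> exp (\<i> * of_real t * lambda_plus ch R L S z)
        = \<alpha> + \<beta> * (2 * ch z a * cnj (chi_sum ch z S) / of_real (gap z - diff z))"
  shows "chi_sum ch z S * cnj (ch z a) \<in> \<real>"
proof -
  have x: "x_diff ch R L (inv z) = x_diff ch R L z"
    using chi_sum_real[OF z sub(1) set_inv(1)] chi_sum_real[OF z sub(2) set_inv(2)]
    by (simp add: x_diff_def chi_sum_inv z sub)
  then have gap: "gap (inv z) = gap z" "diff (inv z) = diff z"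
    by (simp_all add: gap_def diff_def chi_sum_inv z sub)
  have "lambda_plus ch R L S (inv z) = lambda_plus ch R L S z"
    using chi_sum_real[OF z sub(1) set_inv(1)]
    by (simp add: lambda_plus_eq z gap chi_sum_inv sub)
  \<comment> \<open>The equations at \<open>inv z\<close> and at \<open>z\<close> have equal
    left-hand sides; cancel \<alpha> and divide by the nonzero \<beta>.\<close>
  then have "2 * ch (inv z) a * cnj (chi_sum ch (inv z) S) / of_real (gap z - diff z)
      = 2 * ch z a * cnj (chi_sum ch z S) / of_real (gap z - diff z)"
    using plus[OF inv_closed[OF z]] plus[OF z] \<beta> unfolding gap by (simp del: of_real_diff) metis
  then have "ch (inv z) a * cnj (chi_sum ch (inv z) S) = ch z a * cnj (chi_sum ch z S)"
    using gap_diff_pos[OF z S[OF z]] by (simp del: of_real_diff)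
  then have "cnj (chi_sum ch z S * cnj (ch z a)) = chi_sum ch z S * cnj (ch z a)"
    using a z by (simp add: chi_sum_inv sub mult.commute)
  then show ?thesis by (simp add: Reals_cnj_iff)
qed

text \<open>The eigenvalues are real, so both right-hand sides have modulus 1. Expanding the squared
  moduli gives two linear relations between \<open>(norm \<alpha>)\<^sup>2\<close>,
  \<open>(norm \<beta>)\<^sup>2\<close> and the cross term, and a weighted sum eliminates the cross
  term.\<close>

lemma revival_norms:
  assumes z: "z \<in> carrier G" and S: "chi_sum ch z S \<noteq> 0"
    and k: "chi_sum ch z S * cnj c = of_real k" "norm c = 1"
    and plus: "exp (\<i> * of_real t * lambda_plus ch R L S z)
        = \<alpha> + \<beta> * (2 * of_real k / of_real (gap z - diff z))"
    and minus: "exp (\<i> * of_real t * lambda_minus ch R L S z)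
        = \<alpha> - \<beta> * (2 * of_real k / of_real (gap z + diff z))"
  shows "(norm \<alpha>)\<^sup>2 + (norm \<beta>)\<^sup>2 = 1"
proof -
  define p q where "p = gap z - diff z" and "q = gap z + diff z"
  have pos: "p > 0" "q > 0"
    using gap_diff_pos[OF z S] by (simp_all add: p_def q_def)
  have "\<bar>k\<bar> = norm (chi_sum ch z S)"
    using k by (metis complex_mod_cnj mult.right_neutral norm_mult norm_of_real)
  then have pq: "p * q = 4 * k\<^sup>2"
    using gap_diff_product[OF z] by (simp add: p_def q_def) (metis power2_abs)
  have expand: "(norm (\<alpha> + \<beta> * of_real c))\<^sup>2 = (norm \<alpha>)\<^sup>2 + 2 * c * Re (\<alpha> * cnj \<beta>) + c\<^sup>2 * (norm \<beta>)\<^sup>2" for c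
    unfolding cmod_power2 by (simp add: power2_eq_square algebra_simps)
  define A B C where "A = (norm \<alpha>)\<^sup>2" and "B = Re (\<alpha> * cnj \<beta>)" and "C = (norm \<beta>)\<^sup>2"
  note expand = expand[folded A_def B_def C_def]
  \<comment> \<open>As \<open>k\<close> is real with the modulus of the character sum,
    \<open>p * q = 4 * k\<^sup>2\<close> turns the squared coefficients into ratios of
    \<open>p\<close> and \<open>q\<close>.\<close>
  have sq: "(2 * k / p)\<^sup>2 = q / p" "(- 2 * k / q)\<^sup>2 = p / q"
    using pq pos by (simp_all add: power2_eq_square field_simps)
  have "A + 2 * (2 * k / p) * B + q / p * C = 1"
    using norm_exp_lambda(1)[OF z, of t] plus expand[of "2 * k / p"] unfolding sq by (simp add: p_def)
  then have 1: "p * A + 4 * k * B + q * C = p"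
    using pos by (simp add: field_simps)
  have "A + 2 * (- 2 * k / q) * B + p / q * C = 1"
    using norm_exp_lambda(2)[OF z, of t] minus expand[of "- 2 * k / q"] unfolding sq by (simp add: q_def)
  then have 2: "q * A - 4 * k * B + p * C = q"
    using pos by (simp add: field_simps)
  \<comment> \<open>Adding the relations cleared of \<open>p\<close> and \<open>q\<close> cancels
    the terms \<open>4 * k * B\<close>.\<close>
  have "(p + q) * (A + C) = (p + q) * 1"
    using 1 2 by (simp add: algebra_simps)
  then show ?thesis using pos by (simp add: A_def C_def)
qed

text \<open>The column equation yields the scalar equations \<open>?Q\<close>, whose
  \<beta>-coefficients are conjugate to those of \<open>?P\<close>. The reality condition identifies
  the two forms, so each direction must have it before passing between them.\<close>

lemma revival_iff:
  assumes g: "g \<in> carrier G" and h: "h \<in> carrier G" and \<beta>: "\<beta> \<noteq> 0" and a: "a = g \<otimes> inv h"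
  shows "revival \<Gamma> \<alpha> \<beta> (g, 1) (h, 0) t \<longleftrightarrow>
    (\<forall>z\<in>carrier G. chi_sum ch z S \<noteq> 0 \<and> chi_sum ch z S * cnj (ch a z) \<in> \<real>) \<and>
    (\<forall>z\<in>carrier G.
       exp (\<i> * of_real t * lambda_plus ch R L S z)
         = \<alpha> + of_real (d_minus ch R L S z) * inverse (cnj (e_plus ch R L S z)) * \<beta> * cnj (ch a z) \<and>
       exp (\<i> * of_real t * lambda_minus ch R L S z)
         = \<alpha> - of_real (d_plus ch R L S z) * inverse (cnj (e_plus ch R L S z)) * \<beta> * cnj (ch a z))"
    (is "?rev \<longleftrightarrow> ?real \<and> (\<forall>z\<in>carrier G. ?P z)")
proof -
  have a_in: "a \<in> carrier G" using a g h by simp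
  have V: "(g, 1) \<in> fst \<Gamma>" "(h, 0) \<in> fst \<Gamma>"
    using g h by (auto simp: fst_\<Gamma>)
  let ?Q = "\<lambda>z. exp (\<i> * of_real t * lambda_plus ch R L S z)
        = \<alpha> + \<beta> * (2 * ch z a * cnj (chi_sum ch z S) / of_real (gap z - diff z)) \<and>
      exp (\<i> * of_real t * lambda_minus ch R L S z)
        = \<alpha> - \<beta> * (2 * ch z a * cnj (chi_sum ch z S) / of_real (gap z + diff z))"
  let ?C = "\<forall>w\<in>fst \<Gamma>. transition_matrix \<Gamma> t w (g, 1)
        = \<alpha> * unit_vec (g, 1) w + \<beta> * unit_vec (h, 0) w"
  have rev: "?rev \<longleftrightarrow> ?C \<and> (norm \<alpha>)\<^sup>2 + (norm \<beta>)\<^sup>2 = 1"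
    unfolding revival_def mat_vec_unit_vec[OF finite_\<Gamma> V(1)] using V by simp
  have C: "?C \<longleftrightarrow> (\<forall>z\<in>carrier G. ?Q z)" if "\<forall>z\<in>carrier G. chi_sum ch z S \<noteq> 0"
    using transition_column_iff[OF g h] that unfolding a by blast
  have coefficient: "ch z a * cnj (chi_sum ch z S) = chi_sum ch z S * cnj (ch a z)"
    if "chi_sum ch z S * cnj (ch a z) \<in> \<real>" for z
    using that unfolding Reals_cnj_iff by (simp add: sym[of z] mult.commute)
  have PQ: "?P z \<longleftrightarrow> ?Q z"
    if z: "z \<in> carrier G" and S: "chi_sum ch z S \<noteq> 0" and "chi_sum ch z S * cnj (ch a z) \<in> \<real>" for z
    unfolding d_minus_e_plus[OF z S] d_plus_e_plus[OF z S] mult.assoc[of 2] coefficient[OF that(3)]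
    by (simp add: mult_ac del: of_real_add of_real_diff)
  show ?thesis
  proof
    assume ?rev
    then have ?C using rev by blast
    \<comment> \<open>Nonvanishing comes first, since the equivalence \<open>C\<close> is available
      only under it.\<close>
    then have S: "chi_sum ch z S \<noteq> 0" if "z \<in> carrier G" for z
      using transition_column_nonvanishing[OF g h that \<beta>] by blast
    then have Q: "\<forall>z\<in>carrier G. ?Q z" using C \<open>?C\<close> by blast
    have "chi_sum ch z S * cnj (ch z a) \<in> \<real>" if "z \<in> carrier G" for z
      by (rule revival_coefficient_real[OF a_in that \<beta> S]) (use Q in blast)+
    then have ?real using S sym[of a] by simp
    then show "?real \<and> (\<forall>z\<in>carrier G. ?P z)" using PQ Q by blast
  next
    assume r: "?real \<and> (\<forall>z\<in>carrier G. ?P z)"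
    then have Q: "\<forall>z\<in>carrier G. ?Q z" using PQ by blast
    \<comment> \<open>The normalisation needs the two equations at a single \<open>z\<close>; the
      identity is always at hand.\<close>
    have one: "\<one> \<in> carrier G" by simp
    obtain k where k: "chi_sum ch \<one> S * cnj (ch a \<one>) = of_real k"
      using r one by (metis Reals_cases)
    have k': "ch \<one> a * cnj (chi_sum ch \<one> S) = of_real k"
      using coefficient[of \<one>] r one k by simp
    have "(norm \<alpha>)\<^sup>2 + (norm \<beta>)\<^sup>2 = 1"
      using Q one r
      by (intro revival_norms[OF one _ k norm_ch, of t]) (simp_all add: mult.assoc[of 2] k' del: of_real_add of_real_diff)
    then show ?rev using rev C Q r by blast
  qed
qed

end

theorem theorem3p9:
  fixes G :: "('a, 'm) monoid_scheme"
    and r :: nat and m :: "nat \<Rightarrow> nat" and \<phi> :: "'a \<Rightarrow> nat \<Rightarrow> int"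
    and ch :: "'a \<Rightarrow> 'a \<Rightarrow> complex"
    and R L S X :: "'a set" and g h a :: 'a
    and \<alpha> \<beta> :: complex and t :: real
  assumes "comm_group G" and "finite (carrier G)"
    and "\<And>s. s < r \<Longrightarrow> m s > 0"
    and "\<phi> \<in> iso G (cyclic_product r m)"
    and "R \<subseteq> carrier G" and "L \<subseteq> carrier G" and "S \<subseteq> carrier G"
    and "R = set_inv\<^bsub>G\<^esub> R" and "L = set_inv\<^bsub>G\<^esub> L"
    and "\<one>\<^bsub>G\<^esub> \<notin> R \<union> L"
    and "\<alpha> \<noteq> 0" and "\<beta> \<noteq> 0"
    and "g \<in> carrier G" and "h \<in> carrier G"
    and "ch = chi r m \<phi>"
    and "X = {z \<in> carrier G. chi_sum ch z S = 0}"
    and "a = g \<otimes>\<^bsub>G\<^esub> inv\<^bsub>G\<^esub> h"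
  shows "revival (semi_cayley G R L S) \<alpha> \<beta> (g, 1) (h, 0) t \<longleftrightarrow>
    (X = {} \<and> (\<forall>z\<in>carrier G. chi_sum ch z S * cnj (ch a z) \<in> \<real>)) \<and>
    (\<forall>z\<in>carrier G.
       exp (\<i> * complex_of_real t * lambda_plus ch R L S z)
         = \<alpha> + complex_of_real (d_minus ch R L S z) * inverse (cnj (e_plus ch R L S z))
               * \<beta> * cnj (ch a z) \<and>
       exp (\<i> * complex_of_real t * lambda_minus ch R L S z)
         = \<alpha> - complex_of_real (d_plus ch R L S z) * inverse (cnj (e_plus ch R L S z))
               * \<beta> * cnj (ch a z))"
proof -
  interpret bicharacter G ch
    unfolding assms(15) by (rule bicharacter_chi[OF assms(1-4)])
  interpret semi_cayley_bicharacter G ch R L S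
    by unfold_locales (use assms in auto)
  show ?thesis
    using revival_iff[OF assms(13,14,12,17)] unfolding assms(16) by blast
qed

end
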